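(* Let $\Phi:\mathbb R\to\mathbb R$ be a convex continuously differentiable function such that $S=\operatorname{argmin}\Phi\neq\emptyset$. Let $t_0>0$ and let $x:[t_0,+\infty[\to\mathbb R$ be a solution of $$\ddot x(t)+\frac{3}{t}\dot x(t)+\nabla\Phi(x(t))=0 .$$ Then $x(t)$ converges, as $t\to+\infty$, to a point in $S$.
   Context: $\operatorname{argmin}\Phi$ is the set of minimizers of $\Phi$. Solutions are classical global solutions (twice continuously differentiable on $[t_0,+\infty[$); here $\nabla\Phi=\Phi'$. *)

theory Defs
  imports "HOL-Analysis.Analysis"
begin

definition argmin_set :: "(real \<Rightarrow> real) \<Rightarrow> real set"
  where "argmin_set \<Phi> = {z. is_arg_min \<Phi> (\<lambda>_. True) z}"

definition continuously_differentiable :: "(real \<Rightarrow> real) \<Rightarrow> bool"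
  where "continuously_differentiable \<Phi> \<longleftrightarrow>
    (\<forall>y. \<Phi> differentiable (at y)) \<and> continuous_on UNIV (deriv \<Phi>)"

text \<open>
  Classical solutions of \<open>x'' + (3/t) x' + \<Phi>'(x) = 0\<close> on \<open>[t0, \<infinity>)\<close>. The functions \<open>v\<close> and \<open>a\<close> are
  the first and second derivatives of \<open>x\<close>, taken relative to \<open>{t0..}\<close>: they are one-sided at \<open>t0\<close>,
  and the values of \<open>x\<close> to the left of \<open>t0\<close> play no role.
\<close>
definition solution_on_halfline :: "(real \<Rightarrow> real) \<Rightarrow> real \<Rightarrow> (real \<Rightarrow> real) \<Rightarrow> bool"
  where "solution_on_halfline \<Phi> t0 x \<longleftrightarrow>
    (\<exists>v a. (\<forall>t\<in>{t0..}. (x has_real_derivative v t) (at t within {t0..})) \<and>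
           (\<forall>t\<in>{t0..}. (v has_real_derivative a t) (at t within {t0..})) \<and>
           continuous_on {t0..} a \<and>
           (\<forall>t\<in>{t0..}. a t + 3 / t * v t + deriv \<Phi> (x t) = 0))"

end

theory Submission
  imports Defs
begin

text \<open>
  For a minimizer \<open>z\<close> the Lyapunov function
  \<open>E\<^sub>z(t) = t\<^sup>2 (\<Phi>(x) - \<Phi>(z)) + (2 (x - z) + t x')\<^sup>2 / 2\<close> is nonincreasing along the flow,
  because its derivative is \<open>2 t\<close> times the amount by which the tangent of \<open>\<Phi>\<close> at \<open>x\<close> exceeds
  \<open>\<Phi>\<close> at \<open>z\<close>, and convexity makes this nonpositive.  It is also nonnegative, so it
  converges as \<open>t \<rightarrow> \<infinity>\<close>; its boundedness gives \<open>\<Phi>(x(t)) - \<Phi>(z) = O(1 / t\<^sup>2)\<close>.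

  If the minimizer is unique, convexity in dimension one turns \<open>\<Phi>(x(t)) \<rightarrow> min \<Phi>\<close> into
  convergence of \<open>x(t)\<close>.  If there are two minimizers \<open>z \<noteq> w\<close>, then the potential terms and the
  squares of \<open>2 x + t x'\<close> cancel in \<open>E\<^sub>z - E\<^sub>w\<close>, which is therefore a nonconstant affine function
  of the single scalar \<open>2 x + t x'\<close>.  Hence \<open>2 x + t x'\<close> has a limit \<open>L\<close>.  Since
  \<open>(t\<^sup>2 x)' = t (2 x + t x')\<close>, the rule of l'Hospital gives \<open>x(t) \<rightarrow> L / 2\<close>, and by continuity of
  \<open>\<Phi>\<close> this point is a minimizer.  This step uses dimension one: in a Hilbert space
  \<open>E\<^sub>z - E\<^sub>w\<close> only controls the component of \<open>2 x + t x'\<close> along \<open>z - w\<close>.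
\<close>

lemma argmin_set_iff: "z \<in> argmin_set \<Phi> \<longleftrightarrow> (\<forall>y. \<Phi> z \<le> \<Phi> y)"
  by (auto simp: argmin_set_def is_arg_min_def not_less)

lemma nonincreasing_bounded_below_tendsto:
  fixes f :: "real \<Rightarrow> real"
  assumes mono: "\<And>s t. T \<le> s \<Longrightarrow> s \<le> t \<Longrightarrow> f t \<le> f s"
    and bound: "\<And>t. T \<le> t \<Longrightarrow> B \<le> f t"
  obtains l where "(f \<longlongrightarrow> l) at_top"
proof -
  define l where "l = (INF t\<in>{T..}. f t)"
  have bdd: "bdd_below (f ` {T..})"
    using bound by (auto intro!: bdd_belowI[of _ B])
  have "(f \<longlongrightarrow> l) at_top"
  proof (rule order_tendstoI)
    fix c assume "c < l"
    moreover have "l \<le> f t" if "T \<le> t" for t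
      unfolding l_def using that bdd by (intro cINF_lower) auto
    ultimately have "c < f t" if "T \<le> t" for t
      using that by (meson less_le_trans)
    then show "\<forall>\<^sub>F t in at_top. c < f t"
      unfolding eventually_at_top_linorder by blast
  next
    fix c assume "l < c"
    then obtain s where "T \<le> s" "f s < c"
      unfolding l_def using bdd by (subst (asm) cINF_less_iff) auto
    then show "\<forall>\<^sub>F t in at_top. f t < c"
      unfolding eventually_at_top_linorder by (meson mono le_less_trans)
  qed
  then show thesis by (rule that)
qed

text \<open>
  A strict sublevel set of \<open>\<Phi>\<close> is an interval; if its level lies below \<open>\<Phi> (z - e)\<close> and
  \<open>\<Phi> (z + e)\<close>, it cannot reach across these points, so near-minimal values occur only near \<open>z\<close>.
\<close>

lemma convex_on_tendsto_unique_minimizer: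
  fixes \<Phi> :: "real \<Rightarrow> real"
  assumes conv: "convex_on UNIV \<Phi>"
    and unique: "\<And>y. y \<noteq> z \<Longrightarrow> \<Phi> z < \<Phi> y"
    and lim: "((\<lambda>t. \<Phi> (x t)) \<longlongrightarrow> \<Phi> z) F"
  shows "(x \<longlongrightarrow> z) F"
proof (rule tendstoI)
  fix e :: real assume "0 < e"
  define m where "m = min (\<Phi> (z - e)) (\<Phi> (z + e))"
  have m: "\<Phi> z < m" "m \<le> \<Phi> (z - e)" "m \<le> \<Phi> (z + e)"
    using \<open>0 < e\<close> unique[of "z - e"] unique[of "z + e"] by (auto simp: m_def)
  have "convex {y. \<Phi> y < m}"
  proof (rule convexI)
    fix p q u w :: real
    assume *: "p \<in> {y. \<Phi> y < m}" "q \<in> {y. \<Phi> y < m}" "0 \<le> u" "0 \<le> w" "u + w = 1"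
    have "\<Phi> (u *\<^sub>R p + w *\<^sub>R q) \<le> u * \<Phi> p + w * \<Phi> q"
      using conv * by (auto simp: convex_on_def)
    also have "\<dots> < m"
      using * by (auto intro!: convex_bound_lt)
    finally show "u *\<^sub>R p + w *\<^sub>R q \<in> {y. \<Phi> y < m}" by simp
  qed
  then have interval: "is_interval {y. \<Phi> y < m}"
    by (simp add: is_interval_convex_1)
  have near: "dist y z < e" if "\<Phi> y < m" for y
  proof (rule ccontr)
    assume "\<not> dist y z < e"
    then consider "y \<le> z - e" | "z + e \<le> y"
      by (auto simp: dist_real_def abs_if split: if_splits)
    then show False
    proof cases
      case 1
      then have "z - e \<in> {y. \<Phi> y < m}"
        using \<open>0 < e\<close> that m(1) mem_is_interval_1_I[OF interval, of y z "z - e"] by simp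
      then show False using m(2) by simp
    next
      case 2
      then have "z + e \<in> {y. \<Phi> y < m}"
        using \<open>0 < e\<close> that m(1) mem_is_interval_1_I[OF interval, of z y "z + e"] by simp
      then show False using m(3) by simp
    qed
  qed
  show "\<forall>\<^sub>F t in F. dist (x t) z < e"
    using order_tendstoD(2)[OF lim m(1)] by eventually_elim (rule near)
qed

text \<open>
  Multiplied by \<open>t\<close>, the combination \<open>2 x + t x'\<close> is the derivative of \<open>t\<^sup>2 x\<close>, so \<open>x\<close> is
  asymptotically half of a weighted average of it.
\<close>

lemma tendsto_of_double_plus_scaled_derivative:
  fixes x v :: "real \<Rightarrow> real"
  assumes deriv: "\<forall>\<^sub>F t in at_top. (x has_real_derivative v t) (at t)"
    and lim: "((\<lambda>t. 2 * x t + t * v t) \<longlongrightarrow> L) at_top"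
  shows "(x \<longlongrightarrow> L / 2) at_top"
proof -
  have "((\<lambda>t. (t\<^sup>2 * x t) / t\<^sup>2) \<longlongrightarrow> L / 2) at_top"
  proof (rule lhospital_at_top_at_top)
    show "filterlim (\<lambda>t::real. t\<^sup>2) at_top at_top"
      by (rule filterlim_pow_at_top) (auto intro: filterlim_ident)
    show "\<forall>\<^sub>F t::real in at_top. 2 * t \<noteq> 0"
      using eventually_gt_at_top[of 0] by eventually_elim simp
    show "\<forall>\<^sub>F t in at_top. ((\<lambda>t. t\<^sup>2 * x t) has_real_derivative t * (2 * x t + t * v t)) (at t)"
      using deriv
      by eventually_elim (auto intro!: derivative_eq_intros simp: algebra_simps power2_eq_square)
    show "\<forall>\<^sub>F t::real in at_top. ((\<lambda>t. t\<^sup>2) has_real_derivative 2 * t) (at t)"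
      by (auto intro!: always_eventually derivative_eq_intros)
    have "((\<lambda>t. (2 * x t + t * v t) / 2) \<longlongrightarrow> L / 2) at_top"
      using lim by (intro tendsto_divide) auto
    then show "((\<lambda>t. t * (2 * x t + t * v t) / (2 * t)) \<longlongrightarrow> L / 2) at_top"
      by (rule Lim_transform_eventually) (use eventually_gt_at_top[of 0] in eventually_elim, simp)
  qed
  then show ?thesis
    by (rule Lim_transform_eventually) (use eventually_gt_at_top[of 0] in eventually_elim, simp)
qed

text \<open>
  The open half-line \<open>t > t0\<close> makes all derivatives two-sided.
\<close>

locale nesterov_flow =
  fixes \<Phi> x v a :: "real \<Rightarrow> real" and t0 :: real
  assumes convex: "convex_on UNIV \<Phi>"
    and differentiable: "\<And>y. (\<Phi> has_real_derivative deriv \<Phi> y) (at y)"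
    and t0_pos: "t0 > 0"
    and velocity: "\<And>t. t > t0 \<Longrightarrow> (x has_real_derivative v t) (at t)"
    and acceleration: "\<And>t. t > t0 \<Longrightarrow> (v has_real_derivative a t) (at t)"
    and ode: "\<And>t. t > t0 \<Longrightarrow> a t + 3 / t * v t + deriv \<Phi> (x t) = 0"
begin

definition energy :: "real \<Rightarrow> real \<Rightarrow> real"
  where "energy z t = t\<^sup>2 * (\<Phi> (x t) - \<Phi> z) + (2 * (x t - z) + t * v t)\<^sup>2 / 2"

lemma tangent_le: "\<Phi> y + deriv \<Phi> y * (z - y) \<le> \<Phi> z"
  using convex_on_imp_above_tangent[OF convex connected_UNIV _ _ differentiable, of y z]
  by simp

text \<open>
  The equation gives \<open>(2 (x - z) + t x')' = 3 x' + t x'' = - t \<Phi>'(x)\<close>, so the two terms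
  \<open>t\<^sup>2 \<Phi>'(x) x'\<close> arising from the potential and from the square cancel.  This is where
  the factor \<open>2\<close> in the energy and the damping coefficient \<open>3 = 2 + 1\<close> have to match.
\<close>

lemma energy_derivative:
  assumes "t > t0"
  shows "(energy z has_real_derivative
    2 * t * (\<Phi> (x t) + deriv \<Phi> (x t) * (z - x t) - \<Phi> z)) (at t)"
proof -
  have "t > 0" using assms t0_pos by simp
  have damping: "3 * v t + t * a t = - t * deriv \<Phi> (x t)"
    using ode[OF assms] \<open>t > 0\<close> by (simp add: field_simps)
  have potential: "((\<lambda>t. \<Phi> (x t)) has_real_derivative deriv \<Phi> (x t) * v t) (at t)"
    by (rule DERIV_chain2[OF differentiable velocity[OF assms]])
  have "(energy z has_real_derivative
      2 * t * (\<Phi> (x t) - \<Phi> z) + t\<^sup>2 * (deriv \<Phi> (x t) * v t)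
        + (2 * (x t - z) + t * v t) * (3 * v t + t * a t)) (at t)"
    unfolding energy_def[abs_def]
    by (auto intro!: derivative_eq_intros potential velocity[OF assms] acceleration[OF assms]
        simp: field_simps power2_eq_square)
  then show ?thesis
    unfolding damping by (simp add: algebra_simps power2_eq_square)
qed

lemma energy_nonincreasing:
  assumes "t0 < s" "s \<le> t"
  shows "energy z t \<le> energy z s"
proof (rule DERIV_nonpos_imp_nonincreasing[OF \<open>s \<le> t\<close>])
  fix r assume "s \<le> r" "r \<le> t"
  then have "r > t0" "r > 0" using assms t0_pos by auto
  then show "\<exists>d. (energy z has_real_derivative d) (at r) \<and> d \<le> 0"
    using energy_derivative[OF \<open>r > t0\<close>, of z] tangent_le[of "x r" z]
    by (intro exI conjI) (assumption, simp add: mult_le_0_iff)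
qed

lemma gap_le_energy: "t\<^sup>2 * (\<Phi> (x t) - \<Phi> z) \<le> energy z t"
  by (simp add: energy_def)

lemma energy_tendsto:
  assumes "z \<in> argmin_set \<Phi>"
  obtains l where "(energy z \<longlongrightarrow> l) at_top"
proof (rule nonincreasing_bounded_below_tendsto)
  show "energy z t \<le> energy z s" if "t0 + 1 \<le> s" "s \<le> t" for s t
    using that by (intro energy_nonincreasing) auto
  show "0 \<le> energy z t" for t
    using assms by (auto simp: energy_def argmin_set_iff intro!: add_nonneg_nonneg mult_nonneg_nonneg)
qed

lemma potential_tendsto_min:
  assumes "z \<in> argmin_set \<Phi>"
  shows "((\<lambda>t. \<Phi> (x t)) \<longlongrightarrow> \<Phi> z) at_top"
proof -
  define C where "C = energy z (t0 + 1)"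
  have upper: "\<Phi> (x t) \<le> \<Phi> z + C / t\<^sup>2" if "t \<ge> t0 + 1" for t
  proof -
    have "t\<^sup>2 * (\<Phi> (x t) - \<Phi> z) \<le> C"
      using gap_le_energy energy_nonincreasing[of "t0 + 1" t z] that
      unfolding C_def by (meson less_add_one order_trans)
    then show ?thesis
      using that t0_pos by (simp add: field_simps)
  qed
  show ?thesis
  proof (rule tendsto_sandwich)
    show "\<forall>\<^sub>F t in at_top. \<Phi> z \<le> \<Phi> (x t)"
      using assms by (simp add: argmin_set_iff)
    show "\<forall>\<^sub>F t in at_top. \<Phi> (x t) \<le> \<Phi> z + C / t\<^sup>2"
      using eventually_ge_at_top[of "t0 + 1"] by eventually_elim (rule upper)
    have "((\<lambda>t::real. \<Phi> z + C / t\<^sup>2) \<longlongrightarrow> \<Phi> z + 0) at_top"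
      by (intro tendsto_intros real_tendsto_divide_at_top[OF tendsto_const]
          filterlim_pow_at_top filterlim_ident) auto
    then show "((\<lambda>t::real. \<Phi> z + C / t\<^sup>2) \<longlongrightarrow> \<Phi> z) at_top" by simp
  qed simp
qed

lemma energy_difference:
  assumes "\<Phi> z = \<Phi> w"
  shows "energy z t - energy w t = 2 * (w - z) * (2 * x t + t * v t - z - w)"
  using assms by (simp add: energy_def field_simps power2_eq_square)

lemma tendsto_if_two_minimizers:
  assumes z: "z \<in> argmin_set \<Phi>" and w: "w \<in> argmin_set \<Phi>" and "z \<noteq> w"
  obtains l where "(x \<longlongrightarrow> l) at_top"
proof -
  obtain k l where lims: "(energy z \<longlongrightarrow> k) at_top" "(energy w \<longlongrightarrow> l) at_top"
    using energy_tendsto z w by metis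
  have "\<Phi> z = \<Phi> w"
    using z w by (auto simp: argmin_set_iff intro: antisym)
  then have affine: "2 * x t + t * v t = (energy z t - energy w t) / (2 * (w - z)) + z + w" for t
    using energy_difference[of z w t] \<open>z \<noteq> w\<close> by simp
  have "((\<lambda>t. 2 * x t + t * v t) \<longlongrightarrow> (k - l) / (2 * (w - z)) + z + w) at_top"
    unfolding affine using \<open>z \<noteq> w\<close> by (intro tendsto_intros lims) auto
  moreover have "\<forall>\<^sub>F t in at_top. (x has_real_derivative v t) (at t)"
    using eventually_gt_at_top[of t0] by eventually_elim (rule velocity)
  ultimately show thesis
    using that tendsto_of_double_plus_scaled_derivative by blast
qed

theorem converges_to_minimizer:
  assumes "argmin_set \<Phi> \<noteq> {}"
  shows "\<exists>z\<in>argmin_set \<Phi>. (x \<longlongrightarrow> z) at_top"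
proof -
  obtain z where z: "z \<in> argmin_set \<Phi>" using assms by blast
  show ?thesis
  proof (cases "\<exists>w\<in>argmin_set \<Phi>. w \<noteq> z")
    case True
    then obtain l where l: "(x \<longlongrightarrow> l) at_top"
      using z tendsto_if_two_minimizers by metis
    have "((\<lambda>t. \<Phi> (x t)) \<longlongrightarrow> \<Phi> l) at_top"
      using isCont_tendsto_compose[OF DERIV_isCont[OF differentiable] l] .
    then have "\<Phi> l = \<Phi> z"
      using potential_tendsto_min[OF z] by (intro tendsto_unique) auto
    then have "l \<in> argmin_set \<Phi>"
      using z by (simp add: argmin_set_iff)
    then show ?thesis using l by blast
  next
    case False
    have "\<Phi> z < \<Phi> y" if "y \<noteq> z" for y
    proof (rule ccontr)
      assume "\<not> \<Phi> z < \<Phi> y"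
      then have "y \<in> argmin_set \<Phi>"
        using z by (auto simp: argmin_set_iff intro: order_trans[of "\<Phi> y" "\<Phi> z"])
      then show False using False that by blast
    qed
    then have "(x \<longlongrightarrow> z) at_top"
      by (rule convex_on_tendsto_unique_minimizer[OF convex _ potential_tendsto_min[OF z]])
    then show ?thesis using z by blast
  qed
qed

end

theorem theorem3p2:
  fixes \<Phi> x :: "real \<Rightarrow> real" and t0 :: real
  assumes "convex_on UNIV \<Phi>"
    and "continuously_differentiable \<Phi>"
    and "argmin_set \<Phi> \<noteq> {}"
    and "t0 > 0"
    and "solution_on_halfline \<Phi> t0 x"
  shows "\<exists>z\<in>argmin_set \<Phi>. (x \<longlongrightarrow> z) at_top"
proof -
  obtain v a where sol:
    "\<forall>t\<in>{t0..}. (x has_real_derivative v t) (at t within {t0..})"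
    "\<forall>t\<in>{t0..}. (v has_real_derivative a t) (at t within {t0..})"
    "\<forall>t\<in>{t0..}. a t + 3 / t * v t + deriv \<Phi> (x t) = 0"
    using assms(5) unfolding solution_on_halfline_def by (elim exE conjE)
  have interior: "at t within {t0..} = at t" if "t > t0" for t
    using that by (intro at_within_interior) simp
  interpret nesterov_flow \<Phi> x v a t0
  proof
    show "(\<Phi> has_real_derivative deriv \<Phi> y) (at y)" for y
      using assms(2) by (simp add: continuously_differentiable_def DERIV_deriv_iff_real_differentiable)
    show "(x has_real_derivative v t) (at t)" "(v has_real_derivative a t) (at t)" if "t > t0" for t
      using sol(1,2)[THEN bspec, of t] interior[OF that] that by simp_all
    show "a t + 3 / t * v t + deriv \<Phi> (x t) = 0" if "t > t0" for t
      using that by (intro sol(3)[THEN bspec]) simp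
  qed (fact assms)+
  show ?thesis
    by (rule converges_to_minimizer) fact
qed

end
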